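(* Let $\phi\in L^1(\mathbb T)$ and $n\in\mathbb N$. Suppose that the solution $X(z;n-1)$ of the $X$-Riemann--Hilbert problem with parameter $n-1$ and the solution $Z(z;n)$ of the $Z$-Riemann--Hilbert problem with parameter $n$ (both defined in the context) exist. Then $$Z(z;n)=\begin{bmatrix}z+\overset{\infty}{X}_{1,22}(n-1)-\dfrac{\overset{\infty}{X}_{2,12}(n-1)}{\overset{\infty}{X}_{1,12}(n-1)}&-\overset{\infty}{X}_{1,12}(n-1)\\[10pt]\dfrac1{\overset{\infty}{X}_{1,12}(n-1)}&0\end{bmatrix}X(z;n-1),$$ where $\overset{\infty}{X}_{1,jk}$ and $\overset{\infty}{X}_{2,jk}$ are the $jk$-entries of the matrices $\overset{\infty}{X}_1$ and $\overset{\infty}{X}_2$ in the expansion of $X$ as $z\to\infty$.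
   Context: $\mathbb T$ is the unit circle oriented counterclockwise; $\sigma_3=\mathrm{diag}(1,-1)$, so $z^{N\sigma_3}=\mathrm{diag}(z^N,z^{-N})$. The subscripts $+$ and $-$ denote limits at points of $\mathbb T$ from the inside and the outside of the unit circle respectively. $X$-Riemann--Hilbert problem with parameter $N$: find $X(\cdot;N):\mathbb C\setminus\mathbb T\to\mathbb C^{2\times2}$ such that (1) $X(\cdot;N)$ is analytic; (2) the limits $X_\pm(z;N)$ exist, are continuous on $\mathbb T$, and satisfy $X_+(z;N)=X_-(z;N)\begin{bmatrix}1&z^{-N}\phi(z)\\0&1\end{bmatrix}$ for $z\in\mathbb T$; (3) as $z\to\infty$, $X(z;N)=\left(I+\frac{\overset{\infty}{X}_1(N)}{z}+\frac{\overset{\infty}{X}_2(N)}{z^2}+O(z^{-3})\right)z^{N\sigma_3}$. $Z$-Riemann--Hilbert problem with parameter $n$: find $Z(\cdot;n):\mathbb C\setminus\mathbb T\to\mathbb C^{2\times2}$ such that (1) $Z(\cdot;n)$ is analytic; (2) the limits $Z_\pm(z;n)$ exist, are continuous on $\mathbb T$, and satisfy $Z_+(z;n)=Z_-(z;n)\begin{bmatrix}1&z^{-n+1}\phi(z)\\0&1\end{bmatrix}$ for $z\in\mathbb T$; (3) $Z(z;n)=(I+O(z^{-1}))z^{n\sigma_3}$ as $z\to\infty$. *)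

theory Defs
  imports "HOL-Complex_Analysis.Complex_Analysis" "HOL-Library.Landau_Symbols"
begin

abbreviation unit_circle :: "complex set" ("\<T>")
  where "\<T> \<equiv> sphere 0 1"

text \<open>Arc length on the circle is represented by Lebesgue measure in the angle. Elements of
  \<open>L\<^sup>1(\<T>)\<close> are represented by functions, of which only the values almost everywhere on the
  circle matter.\<close>

definition L1_circle :: "(complex \<Rightarrow> complex) \<Rightarrow> bool"
  where "L1_circle \<phi> \<longleftrightarrow> (\<lambda>t. \<phi> (cis t)) absolutely_integrable_on {0..2 * pi}"

definition AE_circle :: "(complex \<Rightarrow> bool) \<Rightarrow> bool"
  where "AE_circle P \<longleftrightarrow> (AE t in lebesgue_on {0..2 * pi}. P (cis t))"

definition mat22 :: "'a::zero \<Rightarrow> 'a \<Rightarrow> 'a \<Rightarrow> 'a \<Rightarrow> 'a^2^2"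
  where "mat22 a b c d = vector [vector [a, b], vector [c, d]]"

definition powi_sigma3 :: "complex \<Rightarrow> int \<Rightarrow> complex^2^2"
  where "powi_sigma3 z N = mat22 (z powi N) 0 0 (z powi (-N))"

definition matrix_analytic_on :: "(complex \<Rightarrow> complex^2^2) \<Rightarrow> complex set \<Rightarrow> bool"
  where "matrix_analytic_on Y S \<longleftrightarrow> (\<forall>i j. (\<lambda>z. Y z $ i $ j) analytic_on S)"

text \<open>The jump condition with an upper triangular jump matrix with off-diagonal entry \<open>w\<close>.
  Since \<open>w\<close> is only determined up to null sets when it comes from an element of \<open>L\<^sup>1(\<T>)\<close>,
  the jump relation is required almost everywhere; the boundary values themselves exist at every
  point of the circle and are continuous.\<close>

definition circle_jump :: "(complex \<Rightarrow> complex) \<Rightarrow> (complex \<Rightarrow> complex^2^2) \<Rightarrow> bool"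
  where "circle_jump w Y \<longleftrightarrow>
    (\<exists>Yp Ym. (\<forall>z\<in>\<T>. (Y \<longlongrightarrow> Yp z) (at z within ball 0 1)) \<and>
             (\<forall>z\<in>\<T>. (Y \<longlongrightarrow> Ym z) (at z within - cball 0 1)) \<and>
             continuous_on \<T> Yp \<and> continuous_on \<T> Ym \<and>
             AE_circle (\<lambda>z. Yp z = Ym z ** mat22 1 (w z) 0 1))"

definition X_expansion ::
    "int \<Rightarrow> (complex \<Rightarrow> complex^2^2) \<Rightarrow> complex^2^2 \<Rightarrow> complex^2^2 \<Rightarrow> bool"
  where "X_expansion N X X1 X2 \<longleftrightarrow>
    (\<exists>E. (\<forall>\<^sub>F z in at_infinity.
            X z = (mat 1 + (\<chi> i j. X1 $ i $ j / z) + (\<chi> i j. X2 $ i $ j / z ^ 2) + E z)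
                  ** powi_sigma3 z N) \<and>
         (\<forall>i j. (\<lambda>z. E z $ i $ j) \<in> O[at_infinity](\<lambda>z. 1 / z ^ 3)))"

definition X_RHP_solution :: "(complex \<Rightarrow> complex) \<Rightarrow> int \<Rightarrow> (complex \<Rightarrow> complex^2^2) \<Rightarrow> bool"
  where "X_RHP_solution \<phi> N X \<longleftrightarrow>
    matrix_analytic_on X (- \<T>) \<and>
    circle_jump (\<lambda>z. z powi (-N) * \<phi> z) X \<and>
    (\<exists>X1 X2. X_expansion N X X1 X2)"

definition Z_RHP_solution :: "(complex \<Rightarrow> complex) \<Rightarrow> int \<Rightarrow> (complex \<Rightarrow> complex^2^2) \<Rightarrow> bool"
  where "Z_RHP_solution \<phi> n Z \<longleftrightarrow>
    matrix_analytic_on Z (- \<T>) \<and>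
    circle_jump (\<lambda>z. z powi (-n + 1) * \<phi> z) Z \<and>
    (\<exists>E. (\<forall>\<^sub>F z in at_infinity. Z z = (mat 1 + E z) ** powi_sigma3 z n) \<and>
         (\<forall>i j. (\<lambda>z. E z $ i $ j) \<in> O[at_infinity](\<lambda>z. 1 / z)))"

end

theory Submission
  imports Defs
begin

text \<open>The pairings \<open>Y\<^sub>i\<^sub>1 X\<^sub>j\<^sub>2 - Y\<^sub>i\<^sub>2 X\<^sub>j\<^sub>1\<close> of rows of two solutions with the same upper unitriangular
  jump have no jump, so they extend to entire functions and are determined by Liouville's theorem
  from their behaviour at infinity. For a single solution this gives determinant \<open>1\<close>. Since
  \<open>z powi (- int n + 1) = z powi (- (int n - 1))\<close>, it also applies to \<open>Z\<close> and \<open>X\<close>, where the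
  pairings are the entries of \<open>R = Z X\<^sup>-\<^sup>1\<close> up to sign and order: \<open>R\<close> has first row
  \<open>(z + a, - X1\<^sub>1\<^sub>2)\<close> and second row \<open>(c, 0)\<close> with constants \<open>a\<close>, \<open>c\<close>. Then \<open>det R = 1\<close> gives
  \<open>c = 1 / X1\<^sub>1\<^sub>2\<close>, and the expansion of the \<open>(1, 2)\<close> entry of \<open>Z = R X\<close> gives \<open>a\<close>.\<close>

unbundle no Formal_Power_Series.fps_syntax

section \<open>Removing the circle: continuous functions that are holomorphic off it\<close>

lemma holomorphic_on_paste_across_circle:
  fixes f :: "complex \<Rightarrow> complex"
  assumes cont: "continuous_on UNIV f" and hol: "f holomorphic_on - \<T>"
  shows "f holomorphic_on UNIV"
proof -
  \<comment> \<open>\<open>exp\<close> pulls the circle back to the imaginary axis, and it is locally invertible away from \<open>0\<close>.\<close>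
  define g where "g = f \<circ> exp"
  have off: "g holomorphic_on {w. Re w \<noteq> 0}"
    unfolding g_def by (rule holomorphic_on_compose_gen[OF _ hol]) (auto intro: holomorphic_intros)
  have g: "g holomorphic_on UNIV"
  \<comment> \<open>The line is \<open>Re w = 0\<close>, whose image under \<open>exp\<close> is the
    circle because \<open>norm (exp w) = exp (Re w)\<close>.\<close>
  proof (rule holomorphic_on_paste_across_line[of UNIV 1 g 0])
    show "continuous_on UNIV g"
      unfolding g_def by (intro continuous_on_compose continuous_on_subset[OF cont] continuous_intros) auto
  qed (auto intro!: holomorphic_on_subset[OF off] simp: inner_complex_def)
  have "f field_differentiable at a" for a
  proof (cases "a = 0")
    case True
    then show ?thesis
      using holomorphic_on_imp_differentiable_at[OF hol, of 0] by (simp add: open_Compl)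
  next
    case False
    \<comment> \<open>The plane cut along the ray from \<open>0\<close> opposite to
      \<open>a\<close>. On it \<open>Ln (z / a) + Ln a\<close> is a holomorphic logarithm of
      \<open>z\<close>, wherever \<open>a\<close> lies relative to the cut of
      \<open>Ln\<close>.\<close>
    define S where "S = {z. z / a \<notin> \<real>\<^sub>\<le>\<^sub>0}"
    have "open S"
      unfolding S_def Collect_neg_eq vimage_def[symmetric] using False
      by (intro open_Compl closed_vimage closed_nonpos_Reals_complex continuous_intros) auto
    have "a \<in> S"
      using False by (simp add: S_def)
    have "(g \<circ> (\<lambda>z. Ln (z / a) + Ln a)) holomorphic_on S"
      by (rule holomorphic_on_compose_gen[OF _ g])
         (auto simp: S_def False intro!: holomorphic_intros)
    moreover have "(g \<circ> (\<lambda>z. Ln (z / a) + Ln a)) z = f z" if "z \<in> S" for z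
    proof -
      have "z \<noteq> 0"
        using that by (auto simp: S_def)
      then show ?thesis
        using False by (simp add: g_def exp_add)
    qed
    ultimately have "f holomorphic_on S"
      by (rule holomorphic_transform)
    then show ?thesis
      using \<open>open S\<close> \<open>a \<in> S\<close> by (rule holomorphic_on_imp_differentiable_at)
  qed
  then show ?thesis
    by (simp add: holomorphic_on_def field_differentiable_at_within)
qed

text \<open>Filling in \<open>b\<close> on the circle gives a function with the limit
  \<open>b z\<close> along each of the three pieces disc, exterior and circle, hence a continuous
  one, and the circle is removable.\<close>

lemma entire_if_no_jump:
  fixes f b :: "complex \<Rightarrow> complex"
  assumes hol: "f holomorphic_on - \<T>" and b: "continuous_on \<T> b"
    and inside: "\<And>z. z \<in> \<T> \<Longrightarrow> (f \<longlongrightarrow> b z) (at z within ball 0 1)"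
    and outside: "\<And>z. z \<in> \<T> \<Longrightarrow> (f \<longlongrightarrow> b z) (at z within - cball 0 1)"
  obtains F where "F holomorphic_on UNIV" "\<And>z. z \<in> - \<T> \<Longrightarrow> F z = f z"
proof
  define F where "F = (\<lambda>z. if z \<in> \<T> then b z else f z)"
  show eq: "F z = f z" if "z \<in> - \<T>" for z
    using that by (simp add: F_def)
  have holF: "F holomorphic_on - \<T>"
    using hol eq by (metis (no_types, lifting) holomorphic_cong)
  have "isCont F z" for z
  proof (cases "z \<in> \<T>")
    case False
    then show ?thesis
      using continuous_on_interior[OF holomorphic_on_imp_continuous_on[OF holF]]
      by (simp add: interior_open open_Compl)
  next
    case True
    have "(F \<longlongrightarrow> b z) (at z within ball 0 1)"
      using inside[OF True] by (rule tendsto_cong[THEN iffD1, rotated])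
        (auto simp: F_def eventually_at_filter)
    moreover have "(F \<longlongrightarrow> b z) (at z within - cball 0 1)"
      using outside[OF True] by (rule tendsto_cong[THEN iffD1, rotated])
        (auto simp: F_def eventually_at_filter)
    moreover have "(b \<longlongrightarrow> b z) (at z within \<T>)"
      using b True by (auto simp: continuous_on_def)
    then have "(F \<longlongrightarrow> b z) (at z within \<T>)"
      by (rule tendsto_cong[THEN iffD1, rotated]) (auto simp: F_def eventually_at_filter)
    ultimately have "(F \<longlongrightarrow> b z) (at z within (ball 0 1 \<union> - cball 0 1) \<union> \<T>)"
      by (intro Lim_Un)
    moreover have "(ball 0 1 \<union> - cball 0 1) \<union> \<T> = (UNIV :: complex set)"
      by auto
    ultimately show ?thesis
      using True by (simp add: isCont_def F_def)
  qed
  then show "F holomorphic_on UNIV"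
    using holF by (intro holomorphic_on_paste_across_circle continuous_at_imp_continuous_on) auto
qed

section \<open>Pairings of rows of two solutions with the same jump\<close>

lemma AE_circle_continuous_eq:
  fixes f g :: "complex \<Rightarrow> complex"
  assumes f: "continuous_on \<T> f" and g: "continuous_on \<T> g"
    and AE: "AE_circle (\<lambda>z. f z = g z)" and z: "z \<in> \<T>"
  shows "f z = g z"
proof -
  define C where "C = {t. f (cis t) = g (cis t)}"
  have "closed C"
    unfolding C_def
    by (intro closed_Collect_eq continuous_on_compose2[OF f] continuous_on_compose2[OF g]) (auto intro!: continuous_intros)
  have AE': "AE t\<in>{0<..<2*pi} in lebesgue. t \<in> C"
    using AE unfolding AE_circle_def C_def
    by (subst (asm) AE_restrict_space_iff) (auto elim: eventually_mono)
  \<comment> \<open>A closed set that contains almost every point of an open set contains all of it;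
    the closure then supplies the endpoints.\<close>
  have "{0<..<2*pi} \<subseteq> C"
    using mem_closed_if_AE_lebesgue_open[OF open_greaterThanLessThan \<open>closed C\<close> AE']
    by (rule subsetI)
  then have "closure {0<..<2*pi} \<subseteq> C"
    using \<open>closed C\<close> by (rule closure_minimal)
  then have "{0..2*pi} \<subseteq> C"
    by simp
  moreover have "Arg2pi z \<in> {0..2*pi}"
    using Arg2pi_ge_0 Arg2pi_lt_2pi by (auto simp: less_imp_le)
  moreover have "cis (Arg2pi z) = z"
    using z Arg2pi_eq[of z] by (simp add: cis_conv_exp)
  ultimately show ?thesis
    by (force simp: C_def)
qed

text \<open>The pairing is the determinant with rows \<open>i\<close> of \<open>Y\<close> and
  \<open>j\<close> of \<open>X\<close>. Multiplying both rows by the same matrix of determinant 1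
  preserves it, so the terms with \<open>w\<close> cancel. Its two boundary values thus agree almost
  everywhere, and everywhere by continuity.\<close>

lemma circle_jump_rows_det_entire:
  fixes X Y :: "complex \<Rightarrow> complex^2^2" and i j :: 2
  assumes "matrix_analytic_on Y (- \<T>)" "circle_jump w Y"
    and "matrix_analytic_on X (- \<T>)" "circle_jump w X"
  obtains F where "F holomorphic_on UNIV"
    "\<And>z. z \<in> - \<T> \<Longrightarrow> F z = Y z $ i $ 1 * X z $ j $ 2 - Y z $ i $ 2 * X z $ j $ 1"
proof -
  obtain Yp Ym where Y: "\<forall>z\<in>\<T>. (Y \<longlongrightarrow> Yp z) (at z within ball 0 1)"
      "\<forall>z\<in>\<T>. (Y \<longlongrightarrow> Ym z) (at z within - cball 0 1)"
      "continuous_on \<T> Yp" "continuous_on \<T> Ym"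
      "AE_circle (\<lambda>z. Yp z = Ym z ** mat22 1 (w z) 0 1)"
    using assms(2) unfolding circle_jump_def by blast
  obtain Xp Xm where X: "\<forall>z\<in>\<T>. (X \<longlongrightarrow> Xp z) (at z within ball 0 1)"
      "\<forall>z\<in>\<T>. (X \<longlongrightarrow> Xm z) (at z within - cball 0 1)"
      "continuous_on \<T> Xp" "continuous_on \<T> Xm"
      "AE_circle (\<lambda>z. Xp z = Xm z ** mat22 1 (w z) 0 1)"
    using assms(4) unfolding circle_jump_def by blast
  define D where "D U V = U $ i $ 1 * V $ j $ 2 - U $ i $ 2 * V $ j $ 1"
    for U V :: "complex^2^2"
  have "AE_circle (\<lambda>z. D (Yp z) (Xp z) = D (Ym z) (Xm z))"
    using Y(5) X(5) unfolding AE_circle_def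
    by eventually_elim
       (simp add: D_def matrix_matrix_mult_def mat22_def sum_2 algebra_simps)
  moreover have cont: "continuous_on \<T> (\<lambda>z. D (Yp z) (Xp z))" "continuous_on \<T> (\<lambda>z. D (Ym z) (Xm z))"
    unfolding D_def by (intro continuous_intros X Y)+
  ultimately have eq: "D (Yp z) (Xp z) = D (Ym z) (Xm z)" if "z \<in> \<T>" for z
    using that by (intro AE_circle_continuous_eq[of "\<lambda>z. D (Yp z) (Xp z)" "\<lambda>z. D (Ym z) (Xm z)"])
  have hol: "(\<lambda>z. D (Y z) (X z)) holomorphic_on - \<T>"
    using assms(1,3) unfolding D_def matrix_analytic_on_def
    by (intro holomorphic_intros analytic_imp_holomorphic) auto
  have inside: "((\<lambda>z. D (Y z) (X z)) \<longlongrightarrow> D (Yp z) (Xp z)) (at z within ball 0 1)" if "z \<in> \<T>" for z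
    unfolding D_def by (intro tendsto_intros X(1)[rule_format, OF that] Y(1)[rule_format, OF that])
  have outside: "((\<lambda>z. D (Y z) (X z)) \<longlongrightarrow> D (Yp z) (Xp z)) (at z within - cball 0 1)" if "z \<in> \<T>" for z
    unfolding eq[OF that] unfolding D_def
    by (intro tendsto_intros X(2)[rule_format, OF that] Y(2)[rule_format, OF that])
  show ?thesis
    by (rule entire_if_no_jump[OF hol cont(1) inside outside]) (use that in \<open>auto simp: D_def\<close>)
qed

lemma Liouville_bigo:
  assumes hol: "f holomorphic_on UNIV" and bound: "f \<in> O[at_infinity](\<lambda>_. 1)"
  obtains c where "\<And>z. f z = c"
proof -
  obtain B where "\<forall>\<^sub>F z in at_infinity. norm (f z) \<le> B"
    using bound by (auto elim!: landau_o.bigE)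
  \<comment> \<open>The factor \<open>norm z ^ 0\<close> casts the bound as the degree 0 case of
    \<open>Liouville_polynomial\<close>.\<close>
  then obtain A where "\<And>z. A \<le> norm z \<Longrightarrow> norm (f z) \<le> B * norm z ^ 0"
    by (auto simp: eventually_at_infinity)
  note Liouville = Liouville_polynomial[OF hol this]
  have "f z = f 0" for z
    by (subst Liouville[of _ z]) simp_all
  then show ?thesis
    by (rule that)
qed

text \<open>For pairings known at infinity only up to a bounded term. The entire function
  \<open>p\<close> absorbs the growth; it is \<open>0\<close> or \<open>z\<close> for the entries of
  the first column of \<open>R\<close>.\<close>

lemma circle_jump_rows_det_eq:
  fixes X Y :: "complex \<Rightarrow> complex^2^2" and i j :: 2
  assumes "matrix_analytic_on Y (- \<T>)" "circle_jump w Y"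
    and "matrix_analytic_on X (- \<T>)" "circle_jump w X"
    and p: "p holomorphic_on UNIV"
    and bound: "(\<lambda>z. Y z $ i $ 1 * X z $ j $ 2 - Y z $ i $ 2 * X z $ j $ 1 - p z) \<in> O[at_infinity](\<lambda>_. 1)"
  obtains c where "\<And>z. z \<in> - \<T> \<Longrightarrow> Y z $ i $ 1 * X z $ j $ 2 - Y z $ i $ 2 * X z $ j $ 1 = p z + c"
proof -
  define D where "D z = Y z $ i $ 1 * X z $ j $ 2 - Y z $ i $ 2 * X z $ j $ 1" for z
  obtain F where F: "F holomorphic_on UNIV" "\<And>z. z \<in> - \<T> \<Longrightarrow> F z = D z"
    using circle_jump_rows_det_entire[OF assms(1-4)] unfolding D_def by metis
  have "\<forall>\<^sub>F z in at_infinity. z \<in> - \<T>"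
    unfolding eventually_at_infinity by (intro exI[of _ 2]) auto
  then have "\<forall>\<^sub>F z in at_infinity. D z - p z = F z - p z"
    by eventually_elim (simp add: F(2))
  then have "(\<lambda>z. F z - p z) \<in> O[at_infinity](\<lambda>_. 1)"
    using bound unfolding D_def[symmetric] by (rule landau_o.big.in_cong[THEN iffD1])
  then obtain c where "\<And>z. F z - p z = c"
    using Liouville_bigo[of "\<lambda>z. F z - p z"] F(1) p by (auto intro: holomorphic_intros)
  then have "\<And>z. z \<in> - \<T> \<Longrightarrow> D z = p z + c"
    using F(2) by (metis add.commute diff_add_cancel)
  then show ?thesis
    using that unfolding D_def by blast
qed

text \<open>When the pairing has a limit at infinity, Liouville's theorem also identifies the
  constant. This covers both determinants and the second column of \<open>R\<close>.\<close>

lemma circle_jump_rows_det_eq_limit: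
  fixes X Y :: "complex \<Rightarrow> complex^2^2" and i j :: 2
  assumes "matrix_analytic_on Y (- \<T>)" "circle_jump w Y"
    and "matrix_analytic_on X (- \<T>)" "circle_jump w X"
    and lim: "((\<lambda>z. Y z $ i $ 1 * X z $ j $ 2 - Y z $ i $ 2 * X z $ j $ 1) \<longlongrightarrow> l) at_infinity"
    and z: "z \<in> - \<T>"
  shows "Y z $ i $ 1 * X z $ j $ 2 - Y z $ i $ 2 * X z $ j $ 1 = l"
proof -
  define D where "D z = Y z $ i $ 1 * X z $ j $ 2 - Y z $ i $ 2 * X z $ j $ 1" for z
  obtain F where F: "F holomorphic_on UNIV" "\<And>z. z \<in> - \<T> \<Longrightarrow> F z = D z"
    using circle_jump_rows_det_entire[OF assms(1-4)] unfolding D_def by metis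
  have "\<forall>\<^sub>F z in at_infinity. z \<in> - \<T>"
    unfolding eventually_at_infinity by (intro exI[of _ 2]) auto
  then have "\<forall>\<^sub>F z in at_infinity. D z = F z"
    by eventually_elim (simp add: F(2))
  then have "(F \<longlongrightarrow> l) at_infinity"
    using lim unfolding D_def[symmetric] by (rule tendsto_cong[THEN iffD1])
  then show ?thesis
    using Liouville_weak[OF F(1)] F(2)[OF z] by (simp add: D_def)
qed

section \<open>Behaviour at infinity\<close>

lemma tendsto_if_times_bigo_1:
  fixes f :: "complex \<Rightarrow> complex"
  assumes "(\<lambda>z. z * (f z - c)) \<in> O[at_infinity](\<lambda>_. 1)"
  shows "(f \<longlongrightarrow> c) at_infinity"
proof -
  have "(\<lambda>z. inverse z) \<in> o[at_infinity](\<lambda>_. 1 :: complex)"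
    using tendsto_inverse_0 by (intro smalloI_tendsto) auto
  then have "(\<lambda>z. inverse z * (z * (f z - c))) \<in> o[at_infinity](\<lambda>_. 1 * 1)"
    using assms by (rule landau_o.small_big_mult)
  from smalloD_tendsto[OF this]
  have "((\<lambda>z. inverse z * (z * (f z - c))) \<longlongrightarrow> 0) at_infinity"
    by simp
  moreover have "\<forall>\<^sub>F z in at_infinity. inverse z * (z * (f z - c)) = f z - c"
    using eventually_not_equal_at_infinity[of 0] by eventually_elim simp
  ultimately have "((\<lambda>z. f z - c) \<longlongrightarrow> 0) at_infinity"
    by (rule Lim_transform_eventually)
  then show ?thesis
    by (simp add: LIM_zero_iff)
qed

lemma tendsto_imp_bigo_1:
  fixes f :: "complex \<Rightarrow> complex"
  assumes "(f \<longlongrightarrow> l) F"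
  shows "f \<in> O[F](\<lambda>_. 1)"
  using assms by (intro bigoI_tendsto[of _ _ l]) auto

text \<open>The expansion is recast as nested limits, without the error term. Each limit bounds its
  expression, and dividing by \<open>z\<close> then gives the limit one order lower, so only the
  second-order one needs \<open>E\<close>.\<close>

lemma X_expansion_prefactor:
  assumes "X_expansion N X X1 X2"
  obtains A where "\<forall>\<^sub>F z in at_infinity. X z = A z ** powi_sigma3 z N"
    "\<And>i j. ((\<lambda>z. z * (z * (A z $ i $ j - mat 1 $ i $ j) - X1 $ i $ j)) \<longlongrightarrow> X2 $ i $ j) at_infinity"
    "\<And>i j. ((\<lambda>z. z * (A z $ i $ j - mat 1 $ i $ j)) \<longlongrightarrow> X1 $ i $ j) at_infinity"
    "\<And>i j. ((\<lambda>z. A z $ i $ j) \<longlongrightarrow> mat 1 $ i $ j) at_infinity"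
proof -
  obtain E where X: "\<forall>\<^sub>F z in at_infinity.
            X z = (mat 1 + (\<chi> i j. X1 $ i $ j / z) + (\<chi> i j. X2 $ i $ j / z ^ 2) + E z)
                  ** powi_sigma3 z N"
    and E: "\<And>i j. (\<lambda>z. E z $ i $ j) \<in> O[at_infinity](\<lambda>z. 1 / z ^ 3)"
    using assms unfolding X_expansion_def by blast
  define A where "A z = mat 1 + (\<chi> i j. X1 $ i $ j / z) + (\<chi> i j. X2 $ i $ j / z ^ 2) + E z" for z
  have lim2: "((\<lambda>z. z * (z * (A z $ i $ j - mat 1 $ i $ j) - X1 $ i $ j)) \<longlongrightarrow> X2 $ i $ j) at_infinity"
    for i j
  proof -
    have "(\<lambda>z. z ^ 3 * E z $ i $ j) \<in> O[at_infinity](\<lambda>z. z ^ 3 * (1 / z ^ 3))"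
      using E by (intro landau_o.big.mult_left)
    also have "O[at_infinity](\<lambda>z. z ^ 3 * (1 / z ^ 3)) = O[at_infinity](\<lambda>_. 1 :: complex)"
      using eventually_not_equal_at_infinity[of 0]
      by (intro landau_o.big.cong) (auto elim: eventually_mono)
    finally have "(\<lambda>z. z ^ 3 * E z $ i $ j) \<in> O[at_infinity](\<lambda>_. 1)" .
    \<comment> \<open>Multiplied by \<open>z\<close>, the deviation
      \<open>z ^ 2 * E z $ i $ j\<close> from the limit is the bounded function just found.\<close>
    then have "((\<lambda>z. X2 $ i $ j + z ^ 2 * E z $ i $ j) \<longlongrightarrow> X2 $ i $ j) at_infinity"
      by (intro tendsto_if_times_bigo_1) (simp add: power2_eq_square power3_eq_cube mult.assoc)
    moreover have "\<forall>\<^sub>F z in at_infinity. z * (z * (A z $ i $ j - mat 1 $ i $ j) - X1 $ i $ j)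
        = X2 $ i $ j + z ^ 2 * E z $ i $ j"
      using eventually_not_equal_at_infinity[of 0]
      by eventually_elim (simp add: A_def ring_distribs power2_eq_square)
    ultimately show ?thesis
      by (simp add: tendsto_cong)
  qed
  have lim1: "((\<lambda>z. z * (A z $ i $ j - mat 1 $ i $ j)) \<longlongrightarrow> X1 $ i $ j) at_infinity" for i j
    by (rule tendsto_if_times_bigo_1[OF tendsto_imp_bigo_1[OF lim2]])
  have lim0: "((\<lambda>z. A z $ i $ j) \<longlongrightarrow> mat 1 $ i $ j) at_infinity" for i j
    by (rule tendsto_if_times_bigo_1[OF tendsto_imp_bigo_1[OF lim1]])
  from X lim2 lim1 lim0 show ?thesis
    unfolding A_def[symmetric] by (rule that)
qed

text \<open>The normalisation of \<open>Z\<close> names no coefficients, so at first order it yields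
  boundedness instead of a limit.\<close>

lemma Z_RHP_solution_prefactor:
  assumes "Z_RHP_solution \<phi> n Z"
  obtains W where "\<forall>\<^sub>F z in at_infinity. Z z = W z ** powi_sigma3 z n"
    "\<And>i j. (\<lambda>z. z * (W z $ i $ j - mat 1 $ i $ j)) \<in> O[at_infinity](\<lambda>_. 1)"
    "\<And>i j. ((\<lambda>z. W z $ i $ j) \<longlongrightarrow> mat 1 $ i $ j) at_infinity"
proof -
  obtain E where Z: "\<forall>\<^sub>F z in at_infinity. Z z = (mat 1 + E z) ** powi_sigma3 z n"
    and E: "\<And>i j. (\<lambda>z. E z $ i $ j) \<in> O[at_infinity](\<lambda>z. 1 / z)"
    using assms unfolding Z_RHP_solution_def by blast
  have bound: "(\<lambda>z. z * ((mat 1 + E z) $ i $ j - mat 1 $ i $ j)) \<in> O[at_infinity](\<lambda>_. 1)" for i j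
  proof -
    have "(\<lambda>z. z * E z $ i $ j) \<in> O[at_infinity](\<lambda>z. z * (1 / z))"
      using E by (intro landau_o.big.mult_left)
    also have "O[at_infinity](\<lambda>z. z * (1 / z)) = O[at_infinity](\<lambda>_. 1 :: complex)"
      using eventually_not_equal_at_infinity[of 0]
      by (intro landau_o.big.cong) (auto elim: eventually_mono)
    finally show ?thesis
      by simp
  qed
  show ?thesis
    using Z bound tendsto_if_times_bigo_1[OF bound] by (rule that)
qed

lemma mult_powi_sigma3_nth:
  fixes A :: "complex^2^2" and i :: 2
  shows  "(A ** powi_sigma3 z N) $ i $ 1 = A $ i $ 1 * z powi N"
  "(A ** powi_sigma3 z N) $ i $ 2 = A $ i $ 2 * z powi (- N)"
  by (simp_all add: matrix_matrix_mult_def powi_sigma3_def mat22_def sum_2)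

text \<open>Only the difference of the parameters survives: the powers disappear for
  \<open>M = N\<close>, and are \<open>z\<close> and \<open>1 / z\<close> for
  \<open>M = N + 1\<close>, the case of \<open>Z\<close> against \<open>X\<close>.\<close>

lemma rows_det_mult_powi_sigma3:
  fixes A B :: "complex^2^2" and i j :: 2
  assumes "z \<noteq> 0"
  shows "(A ** powi_sigma3 z M) $ i $ 1 * (B ** powi_sigma3 z N) $ j $ 2
      - (A ** powi_sigma3 z M) $ i $ 2 * (B ** powi_sigma3 z N) $ j $ 1
    = z powi (M - N) * (A $ i $ 1 * B $ j $ 2) - z powi (N - M) * (A $ i $ 2 * B $ j $ 1)"
  unfolding mult_powi_sigma3_nth using assms
  by (simp add: power_int_diff power_int_minus field_simps)

lemma rows_det_prefactor_limit:
  fixes A Y :: "complex \<Rightarrow> complex^2^2"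
  assumes Y: "\<forall>\<^sub>F z in at_infinity. Y z = A z ** powi_sigma3 z N"
    and A: "\<And>i j. ((\<lambda>z. A z $ i $ j) \<longlongrightarrow> mat 1 $ i $ j) at_infinity"
  shows "((\<lambda>z. Y z $ 1 $ 1 * Y z $ 2 $ 2 - Y z $ 1 $ 2 * Y z $ 2 $ 1) \<longlongrightarrow> 1) at_infinity"
proof -
  have "((\<lambda>z. A z $ 1 $ 1 * A z $ 2 $ 2 - A z $ 1 $ 2 * A z $ 2 $ 1) \<longlongrightarrow>
      mat 1 $ 1 $ (1::2) * mat 1 $ 2 $ (2::2) - mat 1 $ 1 $ (2::2) * mat 1 $ (2::2) $ 1) at_infinity"
    by (intro tendsto_diff tendsto_mult A)
  moreover have "\<forall>\<^sub>F z in at_infinity. Y z $ 1 $ 1 * Y z $ 2 $ 2 - Y z $ 1 $ 2 * Y z $ 2 $ 1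
      = A z $ 1 $ 1 * A z $ 2 $ 2 - A z $ 1 $ 2 * A z $ 2 $ 1"
    using Y eventually_not_equal_at_infinity[of 0]
    by eventually_elim (simp add: rows_det_mult_powi_sigma3)
  ultimately show ?thesis
    by (simp add: tendsto_cong mat_def)
qed

section \<open>The formula for \<open>Z\<close> in terms of \<open>X\<close>\<close>

theorem theorem1p10:
  fixes \<phi> :: "complex \<Rightarrow> complex" and n :: nat
    and X Z :: "complex \<Rightarrow> complex^2^2" and X1 X2 :: "complex^2^2"
  assumes "L1_circle \<phi>"
    and "X_RHP_solution \<phi> (int n - 1) X"
    and "X_expansion (int n - 1) X X1 X2"
    and "Z_RHP_solution \<phi> (int n) Z"
  shows "X1 $ 1 $ 2 \<noteq> 0 \<and>
    (\<forall>z\<in>- \<T>. Z z = mat22 (z + X1 $ 2 $ 2 - X2 $ 1 $ 2 / X1 $ 1 $ 2) (- (X1 $ 1 $ 2))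
                          (1 / X1 $ 1 $ 2) 0 ** X z)"
proof -
  \<comment> \<open>The exponents \<open>- (int n - 1)\<close> and \<open>- int n + 1\<close> of the
    two jumps both simplify to this one.\<close>
  define w where "w z = z powi (1 - int n) * \<phi> z" for z
  have X: "matrix_analytic_on X (- \<T>)" "circle_jump w X"
    using assms(2) by (simp_all add: X_RHP_solution_def w_def[abs_def])
  have Z: "matrix_analytic_on Z (- \<T>)" "circle_jump w Z"
    using assms(4) by (simp_all add: Z_RHP_solution_def w_def[abs_def])
  from X_expansion_prefactor[OF assms(3)] obtain A
    where A: "\<forall>\<^sub>F z in at_infinity. X z = A z ** powi_sigma3 z (int n - 1)"
    and A2: "\<And>i j. ((\<lambda>z. z * (z * (A z $ i $ j - mat 1 $ i $ j) - X1 $ i $ j)) \<longlongrightarrow> X2 $ i $ j) at_infinity"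
    and A1: "\<And>i j. ((\<lambda>z. z * (A z $ i $ j - mat 1 $ i $ j)) \<longlongrightarrow> X1 $ i $ j) at_infinity"
    and A0: "\<And>i j. ((\<lambda>z. A z $ i $ j) \<longlongrightarrow> mat 1 $ i $ j) at_infinity"
    by blast
  from Z_RHP_solution_prefactor[OF assms(4)] obtain W
    where W: "\<forall>\<^sub>F z in at_infinity. Z z = W z ** powi_sigma3 z (int n)"
    and W1: "\<And>i j. (\<lambda>z. z * (W z $ i $ j - mat 1 $ i $ j)) \<in> O[at_infinity](\<lambda>_. 1)"
    and W0: "\<And>i j. ((\<lambda>z. W z $ i $ j) \<longlongrightarrow> mat 1 $ i $ j) at_infinity"
    by blast
  have inv0: "(inverse \<longlongrightarrow> (0::complex)) at_infinity"
    by (rule tendsto_inverse_0)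

  \<comment> \<open>Since \<open>det X = 1\<close>, row \<open>i\<close> of \<open>R\<close> is
    \<open>(D i 2, - D i 1)\<close>.\<close>
  define D where "D i j z = Z z $ i $ 1 * X z $ j $ 2 - Z z $ i $ 2 * X z $ j $ 1" for i j :: 2 and z
  have D_inf: "\<forall>\<^sub>F z in at_infinity. D i j z =
      z * (W z $ i $ 1 * A z $ j $ 2) - inverse z * (W z $ i $ 2 * A z $ j $ 1)" for i j
    using A W eventually_not_equal_at_infinity[of 0]
    by eventually_elim (simp add: D_def rows_det_mult_powi_sigma3 power_int_minus)
  have bigo: "f \<in> O[at_infinity](\<lambda>_. 1) \<Longrightarrow> g \<in> O[at_infinity](\<lambda>_. 1) \<Longrightarrow>
      (\<lambda>z. f z * g z) \<in> O[at_infinity](\<lambda>_. 1)" for f g :: "complex \<Rightarrow> complex"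
    using landau_o.big.mult[of f at_infinity "\<lambda>_. 1" g "\<lambda>_. 1"] by simp
  note A_bigo = tendsto_imp_bigo_1[OF A0] and W_bigo = tendsto_imp_bigo_1[OF W0]
  note inv_bigo = tendsto_imp_bigo_1[OF inv0]

  have detX: "X z $ 1 $ 1 * X z $ 2 $ 2 - X z $ 1 $ 2 * X z $ 2 $ 1 = 1" if "z \<in> - \<T>" for z
    using circle_jump_rows_det_eq_limit[OF X X rows_det_prefactor_limit[OF A A0] that] .
  have detZ: "Z z $ 1 $ 1 * Z z $ 2 $ 2 - Z z $ 1 $ 2 * Z z $ 2 $ 1 = 1" if "z \<in> - \<T>" for z
    using circle_jump_rows_det_eq_limit[OF Z Z rows_det_prefactor_limit[OF W W0] that] .

  \<comment> \<open>The factor \<open>z\<close> meets \<open>A z $ 1 $ 2\<close>, which tends to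
    \<open>0\<close>, so the pairing has the limit given by \<open>X1\<close>. The subtracted
    \<open>mat 1 $ 1 $ 2\<close> is \<open>0\<close> and only matches the form of
    \<open>A1\<close>.\<close>
  have D_1: "(D i 1 \<longlongrightarrow> mat 1 $ i $ 1 * X1 $ 1 $ 2) at_infinity" for i
  proof -
    have "((\<lambda>z. W z $ i $ 1 * (z * (A z $ 1 $ 2 - mat 1 $ 1 $ (2::2))) - inverse z * (W z $ i $ 2 * A z $ 1 $ 1))
       \<longlongrightarrow> mat 1 $ i $ 1 * X1 $ 1 $ 2 - 0 * (mat 1 $ i $ 2 * mat 1 $ 1 $ (1::2))) at_infinity"
      by (intro tendsto_diff tendsto_mult W0 A0 A1 inv0)
    moreover have "\<forall>\<^sub>F z in at_infinity. D i 1 z =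
       W z $ i $ 1 * (z * (A z $ 1 $ 2 - mat 1 $ 1 $ (2::2))) - inverse z * (W z $ i $ 2 * A z $ 1 $ 1)"
      using D_inf[of i 1] by eventually_elim (simp add: mat_def)
    ultimately show ?thesis
      by (simp add: tendsto_cong)
  qed
  have D11: "D 1 1 z = X1 $ 1 $ 2" and D21: "D 2 1 z = 0" if "z \<in> - \<T>" for z
    using circle_jump_rows_det_eq_limit[OF Z X D_1[unfolded D_def] that]
    by (simp_all add: D_def mat_def)

  \<comment> \<open>Here the factor \<open>z\<close> meets \<open>W z $ 2 $ 1\<close>, for which
    \<open>z * W z $ 2 $ 1\<close> is only known to be bounded; the constant is left open until the
    determinants are compared.\<close>
  have "D 2 2 \<in> O[at_infinity](\<lambda>_. 1)"
  proof -
    have "(\<lambda>z. (z * (W z $ 2 $ 1 - mat 1 $ 2 $ (1::2))) * A z $ 2 $ 2 - inverse z * (W z $ 2 $ 2 * A z $ 2 $ 1))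
        \<in> O[at_infinity](\<lambda>_. 1)"
      by (intro sum_in_bigo bigo W1 A_bigo W_bigo inv_bigo)
    moreover have "\<forall>\<^sub>F z in at_infinity. D 2 2 z =
        (z * (W z $ 2 $ 1 - mat 1 $ 2 $ (1::2))) * A z $ 2 $ 2 - inverse z * (W z $ 2 $ 2 * A z $ 2 $ 1)"
      using D_inf[of 2 2] by eventually_elim (simp add: mat_def)
    ultimately show ?thesis
      by (rule landau_o.big.in_cong[THEN iffD2, rotated])
  qed
  then obtain c where D22: "\<And>z. z \<in> - \<T> \<Longrightarrow> D 2 2 z = c"
    using circle_jump_rows_det_eq[OF Z X, of "\<lambda>_. 0" 2 2] by (auto simp: D_def[abs_def])

  have "(\<lambda>z. D 1 2 z - z) \<in> O[at_infinity](\<lambda>_. 1)"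
  proof -
    \<comment> \<open>Both diagonal factors tend to 1; the split
      \<open>z * (u * v) - z = (z * (u - 1)) * v + z * (v - 1)\<close> bounds what remains after
      subtracting \<open>z\<close>.\<close>
    have "(\<lambda>z. (z * (W z $ 1 $ 1 - mat 1 $ 1 $ (1::2))) * A z $ 2 $ 2 + z * (A z $ 2 $ 2 - mat 1 $ 2 $ (2::2))
         - inverse z * (W z $ 1 $ 2 * A z $ 2 $ 1)) \<in> O[at_infinity](\<lambda>_. 1)"
      by (intro sum_in_bigo bigo W1 A_bigo W_bigo inv_bigo tendsto_imp_bigo_1[OF A1])
    moreover have "\<forall>\<^sub>F z in at_infinity. D 1 2 z - z =
        (z * (W z $ 1 $ 1 - mat 1 $ 1 $ (1::2))) * A z $ 2 $ 2 + z * (A z $ 2 $ 2 - mat 1 $ 2 $ (2::2))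
         - inverse z * (W z $ 1 $ 2 * A z $ 2 $ 1)"
      using D_inf[of 1 2] by eventually_elim (simp add: mat_def algebra_simps)
    ultimately show ?thesis
      by (rule landau_o.big.in_cong[THEN iffD2, rotated])
  qed
  then obtain a where D12: "\<And>z. z \<in> - \<T> \<Longrightarrow> D 1 2 z = z + a"
    using circle_jump_rows_det_eq[OF Z X, of "\<lambda>z. z" 1 2] by (auto simp: D_def)

  \<comment> \<open>Cramer's rule, using \<open>det X = 1\<close>\<close>
  have Z_eq: "Z z $ i $ k = D i 2 z * X z $ 1 $ k - D i 1 z * X z $ 2 $ k" if "z \<in> - \<T>" for z i k
  proof -
    have "D i 2 z * X z $ 1 $ k - D i 1 z * X z $ 2 $ k
        = Z z $ i $ k * (X z $ 1 $ 1 * X z $ 2 $ 2 - X z $ 1 $ 2 * X z $ 2 $ 1)"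
      using exhaust_2[of k] by (auto simp: D_def algebra_simps)
    then show ?thesis
      using detX[OF that] by simp
  qed

  \<comment> \<open>Multiplicativity of the determinant, evaluated at \<open>0\<close> as a
    convenient point off the circle. It gives \<open>c\<close> and the nonvanishing of
    \<open>X1 $ 1 $ 2\<close> together.\<close>
  have "X1 $ 1 $ 2 * c = D 1 1 0 * D 2 2 0 - D 1 2 0 * D 2 1 0"
    using D11[of 0] D21[of 0] D22[of 0] by simp
  also have "\<dots> = (Z 0 $ 1 $ 1 * Z 0 $ 2 $ 2 - Z 0 $ 1 $ 2 * Z 0 $ 2 $ 1) *
      (X 0 $ 1 $ 1 * X 0 $ 2 $ 2 - X 0 $ 1 $ 2 * X 0 $ 2 $ 1)"
    by (simp add: D_def algebra_simps)
  also have "\<dots> = 1"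
    using detX[of 0] detZ[of 0] by simp
  finally have c: "X1 $ 1 $ 2 * c = 1" .
  then have nz: "X1 $ 1 $ 2 \<noteq> 0"
    by auto

  \<comment> \<open>The constant \<open>a\<close> is read off the coefficient of \<open>z powi (- int n)\<close> in the entry \<open>(1, 2)\<close> of \<open>Z = R X\<close>.\<close>
  have "((\<lambda>z. z * (z * (A z $ 1 $ 2 - mat 1 $ 1 $ (2::2)) - X1 $ 1 $ 2) + a * (z * (A z $ 1 $ 2 - mat 1 $ 1 $ (2::2)))
        - X1 $ 1 $ 2 * (z * (A z $ 2 $ 2 - mat 1 $ 2 $ (2::2))))
      \<longlongrightarrow> X2 $ 1 $ 2 + a * X1 $ 1 $ 2 - X1 $ 1 $ 2 * X1 $ 2 $ 2) at_infinity"
    by (intro tendsto_add tendsto_diff tendsto_mult tendsto_const A1 A2)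
  \<comment> \<open>The right side is
    \<open>z * ((z + a) * A z $ 1 $ 2 - X1 $ 1 $ 2 * A z $ 2 $ 2)\<close>; the regrouping cancels
    the two contributions \<open>X1 $ 1 $ 2 * z\<close>, leaving terms with known limits.\<close>
  moreover have "\<forall>\<^sub>F z in at_infinity. z * (z * (A z $ 1 $ 2 - mat 1 $ 1 $ (2::2)) - X1 $ 1 $ 2)
      + a * (z * (A z $ 1 $ 2 - mat 1 $ 1 $ (2::2))) - X1 $ 1 $ 2 * (z * (A z $ 2 $ 2 - mat 1 $ 2 $ (2::2)))
      = W z $ 1 $ 2"
  proof -
    have "\<forall>\<^sub>F z in at_infinity. z \<in> - \<T>"
      unfolding eventually_at_infinity by (intro exI[of _ 2]) auto
    then show ?thesis
      using A W eventually_not_equal_at_infinity[of 0]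
    proof eventually_elim
      case (elim z)
      have "W z $ 1 $ 2 * z powi (- int n)
          = ((z + a) * A z $ 1 $ 2 - X1 $ 1 $ 2 * A z $ 2 $ 2) * z powi (- (int n - 1))"
        using Z_eq[OF elim(1), of 1 2] D12[OF elim(1)] D11[OF elim(1)] elim(2,3)
        by (simp add: mult_powi_sigma3_nth algebra_simps)
      moreover have "z powi (- (int n - 1)) = z * z powi (- int n)"
        using elim(4) power_int_add[of z 1 "- int n"] by simp
      ultimately have "W z $ 1 $ 2 = z * ((z + a) * A z $ 1 $ 2 - X1 $ 1 $ 2 * A z $ 2 $ 2)"
        using elim(4) by simp
      then show ?case
        by (simp add: mat_def algebra_simps)
    qed
  qed
  ultimately have "((\<lambda>z. W z $ 1 $ 2) \<longlongrightarrow> X2 $ 1 $ 2 + a * X1 $ 1 $ 2 - X1 $ 1 $ 2 * X1 $ 2 $ 2) at_infinity"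
    by (rule Lim_transform_eventually)
  \<comment> \<open>As an off-diagonal entry, \<open>W z $ 1 $ 2\<close> tends to \<open>0\<close>,
    which turns its limit into an equation for \<open>a\<close>.\<close>
  then have "X2 $ 1 $ 2 + a * X1 $ 1 $ 2 - X1 $ 1 $ 2 * X1 $ 2 $ 2 = 0"
    using tendsto_unique[OF trivial_limit_at_infinity _ W0[of 1 2]] by (fastforce simp: mat_def)
  then have a: "a = X1 $ 2 $ 2 - X2 $ 1 $ 2 / X1 $ 1 $ 2"
    using nz by (simp add: field_simps)

  have "Z z = mat22 (z + X1 $ 2 $ 2 - X2 $ 1 $ 2 / X1 $ 1 $ 2) (- (X1 $ 1 $ 2))
                (1 / X1 $ 1 $ 2) 0 ** X z" if "z \<in> - \<T>" for z
  proof -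
    have "c = 1 / X1 $ 1 $ 2"
      using c nz by (simp add: field_simps)
    then show ?thesis
      using D11[OF that] D12[OF that] D21[OF that] D22[OF that]
      by (simp add: vec_eq_iff forall_2 Z_eq[OF that] a matrix_matrix_mult_def mat22_def sum_2
            add_diff_eq)
  qed
  with nz show ?thesis
    by blast
qed

end
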